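(* Let $\sigma:\mathbb{R}^2\to(0,\infty)$ be smooth and let $\phi:(\mathbb{R}^2,dx^2+dy^2)\to(\mathbb{R}^2,\sigma^2(du^2+dv^2))$ be a linear map $$\phi(x,y)=\begin{pmatrix}a&b\\ c&d\end{pmatrix}\begin{pmatrix}x\\ y\end{pmatrix},$$ with $a,b,c,d\in\mathbb{R}$. Put $A^1=(a,b)$, $A^2=(c,d)$. Then: (1) $\phi$ is harmonic if and only if $\sigma$ is anti-analytic ($\sigma_w=0$), or $\phi$ is analytic ($\phi_{\bar z}=0$) or anti-analytic ($\phi_z=0$). (2) If $\sigma$ is anti-bianalytic (i.e. $\sigma_{ww}=0$), then the linear map $\phi$ is always a biharmonic map. In particular, for any $p,q\in\mathbb{R}$ with $q\neq0$ such that $p+q(u^2+v^2)$ vanishes nowhere on $\mathbb{R}^2$, the linear map $\phi:(\mathbb{R}^2,dx^2+dy^2)\to(\mathbb{R}^2,(p+q(u^2+v^2))^2(du^2+dv^2))$ given by the same formula with $|A^1|^2\neq|A^2|^2$ or $A^1\cdot A^2\neq0$ is always a proper biharmonic map.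
   Context: All manifolds, maps and tensor fields are smooth. For a map $\phi:(M,g)\to(N,h)$ between Riemannian manifolds the tension field is $\tau(\phi)=\mathrm{Trace}_g\nabla d\phi$; $\phi$ is harmonic if $\tau(\phi)=0$. It is biharmonic if it is a critical point of $\frac12\int_\Omega|\tau(\phi)|^2v_g$ for every compact $\Omega\subset M$, equivalently if $$\tau^2(\phi)=\mathrm{Trace}_g\big(\nabla^\phi\nabla^\phi-\nabla^\phi_{\nabla^M}\big)\tau(\phi)-\mathrm{Trace}_g R^N(d\phi,\tau(\phi))\,d\phi=0,$$ with $R^N(X,Y)Z=[\nabla^N_X,\nabla^N_Y]Z-\nabla^N_{[X,Y]}Z$. A biharmonic map is proper if it is not harmonic. Complex notation: $z=x+iy$, $w=u+iv$, $\phi=\phi^1+i\phi^2$, $\frac{\partial}{\partial z}=\frac12(\frac{\partial}{\partial x}-i\frac{\partial}{\partial y})$, $\frac{\partial}{\partial\bar z}=\frac12(\frac{\partial}{\partial x}+i\frac{\partial}{\partial y})$, $\frac{\partial}{\partial w}=\frac12(\frac{\partial}{\partial u}-i\frac{\partial}{\partial v})$; subscripts denote these derivatives. $|\cdot|$ and $\cdot$ on $A^1,A^2$ are the Euclidean norm and dot product.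
   Formalization: In (1), "only if" is false for singular maps (φ=(x,0), σ=1+v²), so "σ_w=0" is required only on the image of φ there; the literal "if" is kept for all a,b,c,d, and the literal equivalence for ad−bc≠0. *)

theory Defs
  imports "HOL-Analysis.Analysis"
begin

text \<open>Smooth maps between normed spaces: all iterated directional derivatives exist and are
  differentiable, hence continuous.\<close>

primrec times_differentiable :: "nat \<Rightarrow> ('a::real_normed_vector \<Rightarrow> 'b::real_normed_vector) \<Rightarrow> bool" where
  "times_differentiable 0 f \<longleftrightarrow> continuous_on UNIV f"
| "times_differentiable (Suc k) f \<longleftrightarrow>
     (\<forall>x. f differentiable (at x)) \<and>
     (\<forall>v. times_differentiable k (\<lambda>x. frechet_derivative f (at x) v))"

definition smooth :: "('a::real_normed_vector \<Rightarrow> 'b::real_normed_vector) \<Rightarrow> bool" where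
  "smooth f \<longleftrightarrow> (\<forall>k. times_differentiable k f)"

text \<open>A Riemannian metric on \<open>\<real>\<^sup>n\<close> is given by its Gram matrix in the standard global
  coordinates. Everything below is meant for smooth metrics and smooth maps.\<close>

type_synonym 'n metric_field = "real ^ 'n \<Rightarrow> real ^ 'n ^ 'n"

definition flat_metric :: "'n::finite metric_field" where
  "flat_metric = (\<lambda>_. mat 1)"

definition conformal_metric :: "(real ^ 'n \<Rightarrow> real) \<Rightarrow> 'n::finite metric_field" where
  "conformal_metric s = (\<lambda>w. (s w)\<^sup>2 *\<^sub>R mat 1)"

definition partial_deriv :: "'n::finite \<Rightarrow> (real ^ 'n \<Rightarrow> 'b::real_normed_vector) \<Rightarrow> real ^ 'n \<Rightarrow> 'b" where
  "partial_deriv i f x = frechet_derivative f (at x) (axis i 1)"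

definition christoffel :: "'n::finite metric_field \<Rightarrow> real ^ 'n \<Rightarrow> 'n \<Rightarrow> 'n \<Rightarrow> 'n \<Rightarrow> real" where
  "christoffel h p k i j =
     (\<Sum>l\<in>UNIV. matrix_inv (h p) $ k $ l *
        (partial_deriv i (\<lambda>q. h q $ j $ l) p + partial_deriv j (\<lambda>q. h q $ i $ l) p
         - partial_deriv l (\<lambda>q. h q $ i $ j) p)) / 2"

text \<open>The Levi-Civita derivative at \<open>p\<close>, in direction \<open>X\<close>, of the vector field with constant
  coordinates \<open>Y\<close>.\<close>

definition christoffel_form :: "'n::finite metric_field \<Rightarrow> real ^ 'n \<Rightarrow> real ^ 'n \<Rightarrow> real ^ 'n \<Rightarrow> real ^ 'n" where
  "christoffel_form h p X Y =
     (\<chi> k. \<Sum>i\<in>UNIV. \<Sum>j\<in>UNIV. christoffel h p k i j * X $ i * Y $ j)"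

text \<open>The pull-back connection: the derivative at \<open>x\<close>, in direction \<open>v\<close>, of a section \<open>V\<close> of
  the pull-back under \<open>\<phi>\<close> of the tangent bundle of the target. For \<open>\<phi>\<close> the identity it is the
  Levi-Civita connection of \<open>h\<close>.\<close>

definition pullback_deriv ::
  "'n::finite metric_field \<Rightarrow> (real ^ 'm::finite \<Rightarrow> real ^ 'n) \<Rightarrow> real ^ 'm \<Rightarrow> (real ^ 'm \<Rightarrow> real ^ 'n) \<Rightarrow>
   real ^ 'm \<Rightarrow> real ^ 'n" where
  "pullback_deriv h \<phi> v V x =
     frechet_derivative V (at x) v
     + christoffel_form h (\<phi> x) (frechet_derivative \<phi> (at x) v) (V x)"

text \<open>\<open>R(X,Y)Z = [\<nabla>\<^sub>X, \<nabla>\<^sub>Y]Z - \<nabla>\<^bsub>[X,Y]\<^esub>Z\<close>. By tensoriality the vectors \<open>X\<close>, \<open>Y\<close>, \<open>Z\<close> at \<open>p\<close>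
  may be extended with constant coordinates, and then \<open>[X,Y] = 0\<close>.\<close>

definition curvature :: "'n::finite metric_field \<Rightarrow> real ^ 'n \<Rightarrow> real ^ 'n \<Rightarrow> real ^ 'n \<Rightarrow> real ^ 'n \<Rightarrow> real ^ 'n" where
  "curvature h p X Y Z =
     (let D = pullback_deriv h (\<lambda>q. q)
      in D X (D Y (\<lambda>_. Z)) p - D Y (D X (\<lambda>_. Z)) p)"

definition metric_trace ::
  "'m::finite metric_field \<Rightarrow> real ^ 'm \<Rightarrow> (real ^ 'm \<Rightarrow> real ^ 'm \<Rightarrow> 'b::real_vector) \<Rightarrow> 'b" where
  "metric_trace g x B =
     (\<Sum>i\<in>UNIV. \<Sum>j\<in>UNIV. matrix_inv (g x) $ i $ j *\<^sub>R B (axis i 1) (axis j 1))"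

text \<open>\<open>(\<nabla>d\<phi>)(X,Y) = \<nabla>\<^sup>\<phi>\<^sub>X(d\<phi>(Y)) - d\<phi>(\<nabla>\<^sub>XY)\<close>; as before, \<open>X\<close> and \<open>Y\<close> are extended with
  constant coordinates, here and in \<open>bitension\<close>.\<close>

definition second_fundamental_form ::
  "'m::finite metric_field \<Rightarrow> 'n::finite metric_field \<Rightarrow> (real ^ 'm \<Rightarrow> real ^ 'n) \<Rightarrow>
   real ^ 'm \<Rightarrow> real ^ 'm \<Rightarrow> real ^ 'm \<Rightarrow> real ^ 'n" where
  "second_fundamental_form g h \<phi> x X Y =
     pullback_deriv h \<phi> X (\<lambda>y. frechet_derivative \<phi> (at y) Y) x
     - frechet_derivative \<phi> (at x) (christoffel_form g x X Y)"

definition tension ::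
  "'m::finite metric_field \<Rightarrow> 'n::finite metric_field \<Rightarrow> (real ^ 'm \<Rightarrow> real ^ 'n) \<Rightarrow> real ^ 'm \<Rightarrow> real ^ 'n" where
  "tension g h \<phi> x = metric_trace g x (second_fundamental_form g h \<phi> x)"

definition bitension ::
  "'m::finite metric_field \<Rightarrow> 'n::finite metric_field \<Rightarrow> (real ^ 'm \<Rightarrow> real ^ 'n) \<Rightarrow> real ^ 'm \<Rightarrow> real ^ 'n" where
  "bitension g h \<phi> x =
     metric_trace g x (\<lambda>X Y.
       pullback_deriv h \<phi> X (pullback_deriv h \<phi> Y (tension g h \<phi>)) x
       - pullback_deriv h \<phi> (christoffel_form g x X Y) (tension g h \<phi>) x)
     - metric_trace g x (\<lambda>X Y.
         curvature h (\<phi> x) (frechet_derivative \<phi> (at x) X) (tension g h \<phi> x)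
           (frechet_derivative \<phi> (at x) Y))"

definition harmonic_map ::
  "'m::finite metric_field \<Rightarrow> 'n::finite metric_field \<Rightarrow> (real ^ 'm \<Rightarrow> real ^ 'n) \<Rightarrow> bool" where
  "harmonic_map g h \<phi> \<longleftrightarrow> (\<forall>x. tension g h \<phi> x = 0)"

definition biharmonic_map ::
  "'m::finite metric_field \<Rightarrow> 'n::finite metric_field \<Rightarrow> (real ^ 'm \<Rightarrow> real ^ 'n) \<Rightarrow> bool" where
  "biharmonic_map g h \<phi> \<longleftrightarrow> (\<forall>x. bitension g h \<phi> x = 0)"

definition proper_biharmonic_map ::
  "'m::finite metric_field \<Rightarrow> 'n::finite metric_field \<Rightarrow> (real ^ 'm \<Rightarrow> real ^ 'n) \<Rightarrow> bool" where
  "proper_biharmonic_map g h \<phi> \<longleftrightarrow> biharmonic_map g h \<phi> \<and> \<not> harmonic_map g h \<phi>"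

text \<open>The Wirtinger derivatives, for complex functions of \<open>(x,y) \<in> \<real>\<^sup>2\<close>; they serve both
  \<open>z = x + iy\<close> on the source and \<open>w = u + iv\<close> on the target.\<close>

definition d_hol :: "(real ^ 2 \<Rightarrow> complex) \<Rightarrow> real ^ 2 \<Rightarrow> complex" where
  "d_hol f x = (partial_deriv 1 f x - \<i> * partial_deriv 2 f x) / 2"

definition d_antihol :: "(real ^ 2 \<Rightarrow> complex) \<Rightarrow> real ^ 2 \<Rightarrow> complex" where
  "d_antihol f x = (partial_deriv 1 f x + \<i> * partial_deriv 2 f x) / 2"

definition complexify :: "(real ^ 2 \<Rightarrow> real ^ 2) \<Rightarrow> real ^ 2 \<Rightarrow> complex" where
  "complexify \<phi> x = Complex (\<phi> x $ 1) (\<phi> x $ 2)"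

definition analytic_map :: "(real ^ 2 \<Rightarrow> real ^ 2) \<Rightarrow> bool" where
  "analytic_map \<phi> \<longleftrightarrow> (\<forall>x. d_antihol (complexify \<phi>) x = 0)"

definition anti_analytic_map :: "(real ^ 2 \<Rightarrow> real ^ 2) \<Rightarrow> bool" where
  "anti_analytic_map \<phi> \<longleftrightarrow> (\<forall>x. d_hol (complexify \<phi>) x = 0)"

definition anti_analytic_on :: "(real ^ 2) set \<Rightarrow> (real ^ 2 \<Rightarrow> real) \<Rightarrow> bool" where
  "anti_analytic_on S \<sigma> \<longleftrightarrow> (\<forall>w\<in>S. d_hol (\<lambda>w. complex_of_real (\<sigma> w)) w = 0)"

definition anti_bianalytic :: "(real ^ 2 \<Rightarrow> real) \<Rightarrow> bool" where
  "anti_bianalytic \<sigma> \<longleftrightarrow> (\<forall>w. d_hol (d_hol (\<lambda>w. complex_of_real (\<sigma> w))) w = 0)"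

end

theory Submission
  imports Defs
begin

text \<open>
  Write \<open>P\<^sub>i\<close> for the images of the standard basis vectors under a linear map \<open>f\<close> and
  \<open>L = grad \<sigma> / \<sigma>\<close> for the logarithmic gradient of the conformal factor. The Levi-Civita
  connection of \<open>\<sigma>\<^sup>2\<close> times the flat metric differs from the flat one by
  \<open>\<Gamma>(X,Y) = (L \<bullet> Y) X + (L \<bullet> X) Y - (X \<bullet> Y) L\<close>. A linear map has no second derivatives, so its
  tension field is \<open>\<tau> = \<Sum>\<^sub>i \<Gamma>(P\<^sub>i,P\<^sub>i) = M L\<close>, taken along \<open>f\<close>, with the constant symmetric matrix
  \<open>M = \<Sum>\<^sub>i (2 P\<^sub>i P\<^sub>i\<^sup>T - |P\<^sub>i|\<^sup>2)\<close>.

  On a two-dimensional target \<open>M\<close> is trace-free, so by Cayley and Hamilton \<open>M\<^sup>2 = \<mu>\<close> is a scalar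
  matrix and \<open>M\<close> is either \<open>0\<close> or invertible. Hence \<open>f\<close> is harmonic exactly if \<open>M = 0\<close>, which for
  maps of the plane says that \<open>f\<close> is analytic or anti-analytic, or if \<open>L\<close> vanishes along the image
  of \<open>f\<close>, which says that \<open>\<sigma>\<close> is anti-analytic there (\<open>harmonic_linear_iff\<close>,
  \<open>gram_defect_eq_0_iff_analytic\<close>).

  For a real \<open>\<sigma>\<close> the equation \<open>\<sigma>\<^bsub>ww\<^esub> = 0\<close> means \<open>\<sigma>\<^bsub>uu\<^esub> = \<sigma>\<^bsub>vv\<^esub>\<close> and \<open>\<sigma>\<^bsub>uv\<^esub> = 0\<close>. By the symmetry of
  mixed partial derivatives \<open>\<sigma>\<^bsub>uu\<^esub>\<close> then has zero gradient, so the Hessian of \<open>\<sigma>\<close> is a constant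
  multiple \<open>k\<close> of the identity (\<open>anti_bianalytic_hessian\<close>). With \<open>\<kappa> = k / \<sigma>\<close> the derivative of \<open>L\<close>
  in direction \<open>h\<close> is \<open>\<kappa> h - (L \<bullet> h) L\<close>, so everything in the bitension field becomes a polynomial
  in \<open>\<kappa>\<close>, \<open>L\<close> and the \<open>P\<^sub>i\<close>. Put \<open>C = 2 \<kappa> - |L|\<^sup>2\<close>; this is the Laplacian of \<open>log \<sigma>\<close>, that is,
  \<open>-\<sigma>\<^sup>2\<close> times the Gauss curvature. The rough Laplacian of \<open>\<tau>\<close> is
  \<open>C (\<Sum>\<^sub>i (P\<^sub>i \<bullet> \<tau>) P\<^sub>i - \<mu> L)\<close> and the curvature term is \<open>C \<Sum>\<^sub>i (|P\<^sub>i|\<^sup>2 \<tau> - (P\<^sub>i \<bullet> \<tau>) P\<^sub>i)\<close>. Their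
  difference is \<open>C (M \<tau> - \<mu> L)\<close>, and this vanishes because \<open>M \<tau> = M\<^sup>2 L = \<mu> L\<close>
  (\<open>biharmonic_linear\<close>). The metric depends on \<open>\<sigma>\<^sup>2\<close> only, so the factors
  \<open>p + q (u\<^sup>2 + v\<^sup>2)\<close> of either sign are covered as well; for these \<open>L\<close> is not zero away from the
  origin, and so \<open>f\<close> is not harmonic as soon as \<open>M \<noteq> 0\<close>.
\<close>

section \<open>Conformal metrics\<close>

lemma partial_deriv_eq:
  "(f has_derivative f') (at x) \<Longrightarrow> partial_deriv i f x = f' (axis i 1)"
  unfolding partial_deriv_def by (metis frechet_derivative_at)

lemma matrix_inv_scaleR_mat:
  fixes s :: real
  assumes "s \<noteq> 0"
  shows "matrix_inv (s *\<^sub>R mat 1 :: real ^ 'n::finite ^ 'n) = (1 / s) *\<^sub>R mat 1"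
proof -
  have inv: "A = (1 / s) *\<^sub>R mat 1"
    if "(s *\<^sub>R mat 1 :: real ^ 'n ^ 'n) ** A = mat 1" for A
    using that assms by (simp add: scalar_matrix_assoc[symmetric] matrix_mul_lid)
      (metis inverse_eq_divide scaleR_left.add scaleR_one scaleR_scaleR left_inverse)
  show ?thesis
    unfolding matrix_inv_def
  proof (rule someI2)
    show "s *\<^sub>R mat 1 ** ((1 / s) *\<^sub>R mat 1) = (mat 1 :: real ^ 'n ^ 'n) \<and>
      (1 / s) *\<^sub>R mat 1 ** (s *\<^sub>R mat 1) = (mat 1 :: real ^ 'n ^ 'n)"
      using assms by (simp add: scalar_matrix_assoc[symmetric] matrix_mul_lid)
  qed (use inv in blast)
qed

lemma matrix_inv_flat: "matrix_inv (flat_metric p) = mat 1"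
  using matrix_inv_scaleR_mat[of 1] by (simp add: flat_metric_def)

lemma metric_trace_flat:
  fixes x :: "real ^ 'm::finite"
  shows "metric_trace flat_metric x B = (\<Sum>i\<in>UNIV. B (axis i 1) (axis i 1))"
proof -
  have "(mat 1 :: real ^ 'm ^ 'm) $ i $ j *\<^sub>R B (axis i 1) (axis j 1) =
      (if i = j then B (axis i 1) (axis j 1) else 0)" for i j
    by (simp add: mat_def)
  then show ?thesis
    unfolding metric_trace_def matrix_inv_flat by simp
qed

lemma christoffel_form_flat [simp]: "christoffel_form flat_metric p X Y = 0"
  by (simp add: christoffel_form_def christoffel_def flat_metric_def partial_deriv_def vec_eq_iff)

text \<open>The difference tensor between the Levi-Civita connections of \<open>\<sigma>\<^sup>2\<close> times the flat metric and
  of the flat metric, where \<open>L = grad \<sigma> / \<sigma>\<close>.\<close>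
definition conformal_form :: "'a::real_inner \<Rightarrow> 'a \<Rightarrow> 'a \<Rightarrow> 'a" where
  "conformal_form L X Y = (L \<bullet> Y) *\<^sub>R X + (L \<bullet> X) *\<^sub>R Y - (X \<bullet> Y) *\<^sub>R L"

text \<open>The Gram matrix is a multiple of the identity, so each of the three terms of the Christoffel
  symbol carries a Kronecker delta and contributes one of the three terms of the form.\<close>
lemma christoffel_form_conformal:
  fixes \<sigma> :: "real ^ 'n::finite \<Rightarrow> real"
  assumes nz: "\<sigma> p \<noteq> 0" and grad: "(\<sigma> has_derivative (\<lambda>h. g \<bullet> h)) (at p)"
  shows "christoffel_form (conformal_metric \<sigma>) p X Y = conformal_form ((1 / \<sigma> p) *\<^sub>R g) X Y"
proof -
  let ?L = "(1 / \<sigma> p) *\<^sub>R g"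
  let ?\<delta> = "\<lambda>i j. if i = j then 1 else (0::real)"
  have "((\<lambda>q. conformal_metric \<sigma> q $ i $ j) has_derivative (\<lambda>h. 2 * \<sigma> p * (g \<bullet> h) * ?\<delta> i j)) (at p)" for i j
    unfolding conformal_metric_def
    by (auto intro!: derivative_eq_intros grad simp: mat_def fun_eq_iff)
  then have der: "partial_deriv l (\<lambda>q. conformal_metric \<sigma> q $ i $ j) p = 2 * \<sigma> p * g $ l * ?\<delta> i j" for l i j
    by (rule partial_deriv_eq[THEN trans]) (simp add: inner_axis)
  have inv: "matrix_inv (conformal_metric \<sigma> p) $ k $ l = (1 / (\<sigma> p)\<^sup>2) * ?\<delta> k l" for k l
    using nz unfolding conformal_metric_def by (subst matrix_inv_scaleR_mat) (simp_all add: mat_def)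
  have chr: "christoffel (conformal_metric \<sigma>) p k i j =
      ?\<delta> j k * ?L $ i + ?\<delta> i k * ?L $ j - ?\<delta> i j * ?L $ k" for k i j
  proof -
    have "christoffel (conformal_metric \<sigma>) p k i j =
      (\<Sum>l\<in>UNIV. ?\<delta> k l * (?\<delta> j l * ?L $ i + ?\<delta> i l * ?L $ j - ?\<delta> i j * ?L $ l))"
      unfolding christoffel_def der inv sum_divide_distrib
      using nz by (intro sum.cong refl) (simp add: field_simps power2_eq_square)
    also have "\<dots> = (\<Sum>l\<in>UNIV. if k = l then ?\<delta> j l * ?L $ i + ?\<delta> i l * ?L $ j - ?\<delta> i j * ?L $ l else 0)"
      by (intro sum.cong) auto
    finally show ?thesis by (simp add: if_distrib cong: if_cong)
  qed
  have "christoffel_form (conformal_metric \<sigma>) p X Y $ k = conformal_form ?L X Y $ k" for k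
  proof -
    have "christoffel_form (conformal_metric \<sigma>) p X Y $ k =
      (\<Sum>i\<in>UNIV. \<Sum>j\<in>UNIV. (?\<delta> j k * Y $ j) * (?L $ i * X $ i)) +
      (\<Sum>i\<in>UNIV. \<Sum>j\<in>UNIV. (?\<delta> i k * X $ i) * (?L $ j * Y $ j)) -
      (\<Sum>i\<in>UNIV. \<Sum>j\<in>UNIV. ?\<delta> i j * (?L $ k * X $ i * Y $ j))"
      unfolding christoffel_form_def chr
      by (simp add: algebra_simps sum.distrib sum_subtractf)
    also have "(\<Sum>i\<in>UNIV. \<Sum>j\<in>UNIV. (?\<delta> j k * Y $ j) * (?L $ i * X $ i)) =
        (\<Sum>j\<in>UNIV. ?\<delta> j k * Y $ j) * (\<Sum>i\<in>UNIV. ?L $ i * X $ i)"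
      by (subst sum.swap) (simp only: sum_product)
    also have "(\<Sum>i\<in>UNIV. \<Sum>j\<in>UNIV. (?\<delta> i k * X $ i) * (?L $ j * Y $ j)) =
        (\<Sum>i\<in>UNIV. ?\<delta> i k * X $ i) * (\<Sum>j\<in>UNIV. ?L $ j * Y $ j)"
      by (simp only: sum_product)
    also have "(\<Sum>i\<in>UNIV. \<Sum>j\<in>UNIV. ?\<delta> i j * (?L $ k * X $ i * Y $ j)) = ?L $ k * (\<Sum>i\<in>UNIV. X $ i * Y $ i)"
      by (simp add: sum_distrib_left if_distrib[of "\<lambda>x. x * _"] mult.assoc del: vector_scaleR_component cong: if_cong)
    also have "(\<Sum>j\<in>UNIV. ?\<delta> j k * Y $ j) = Y $ k"
      by (simp add: if_distrib[of "\<lambda>x. x * _"] cong: if_cong)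
    also have "(\<Sum>j\<in>UNIV. ?\<delta> j k * X $ j) = X $ k"
      by (simp add: if_distrib[of "\<lambda>x. x * _"] cong: if_cong)
    finally show ?thesis
      by (simp add: conformal_form_def inner_vec_def algebra_simps)
  qed
  then show ?thesis by (simp add: vec_eq_iff)
qed

section \<open>Linear maps into a conformally flat space\<close>

text \<open>The symmetric operator \<open>2 f f\<^sup>T - |f|\<^sup>2\<close> on the target, with \<open>|f|\<close> the Frobenius norm. For a
  two-dimensional target it is twice the trace-free part of \<open>f f\<^sup>T\<close>, and so it vanishes exactly if
  \<open>f f\<^sup>T\<close> is a multiple of the identity.\<close>
definition gram_defect :: "(real ^ 'm::finite \<Rightarrow> real ^ 'n::finite) \<Rightarrow> real ^ 'n \<Rightarrow> real ^ 'n" where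
  "gram_defect f v =
     (\<Sum>i\<in>UNIV. (2 * (f (axis i 1) \<bullet> v)) *\<^sub>R f (axis i 1) - (f (axis i 1) \<bullet> f (axis i 1)) *\<^sub>R v)"

lemma bounded_linear_gram_defect: "bounded_linear (gram_defect f)"
  unfolding gram_defect_def
  by (intro bounded_linear_sum bounded_linear_sub bounded_linear_const_scaleR
      bounded_linear_ident bounded_linear_scaleR_const bounded_linear_const_mult
      bounded_linear_inner_right)

lemma gram_defect_scaleR: "gram_defect f (c *\<^sub>R v) = c *\<^sub>R gram_defect f v"
  by (rule bounded_linear.linear[OF bounded_linear_gram_defect, THEN linear_cmul])

lemma gram_defect_diff: "gram_defect f (u - v) = gram_defect f u - gram_defect f v"
  by (rule bounded_linear.linear[OF bounded_linear_gram_defect, THEN linear_diff])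

lemma inner_gram_defect_commute: "gram_defect f u \<bullet> v = u \<bullet> gram_defect f v"
  unfolding gram_defect_def inner_sum_left inner_sum_right
  by (intro sum.cong refl) (simp add: inner_simps inner_commute)

lemma frechet_derivative_linear:
  fixes f :: "'a::euclidean_space \<Rightarrow> 'b::real_normed_vector"
  assumes "linear f" shows "frechet_derivative f (at x) = f"
  using linear_imp_has_derivative[OF assms] by (metis frechet_derivative_at)

text \<open>Only the Christoffel term survives, because \<open>f\<close> has no second derivatives; its trace over the
  source is the defect operator applied to the logarithmic gradient.\<close>
lemma tension_linear:
  fixes f :: "real ^ 'm::finite \<Rightarrow> real ^ 'n::finite"
  assumes lin: "linear f" and nz: "\<sigma> (f x) \<noteq> 0"
    and grad: "(\<sigma> has_derivative (\<lambda>h. g \<bullet> h)) (at (f x))"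
  shows "tension flat_metric (conformal_metric \<sigma>) f x = gram_defect f ((1 / \<sigma> (f x)) *\<^sub>R g)"
proof -
  have "tension flat_metric (conformal_metric \<sigma>) f x =
     (\<Sum>i\<in>UNIV. conformal_form ((1 / \<sigma> (f x)) *\<^sub>R g) (f (axis i 1)) (f (axis i 1)))"
    unfolding tension_def metric_trace_flat second_fundamental_form_def pullback_deriv_def
    by (simp add: frechet_derivative_linear[OF lin] linear_0[OF lin] christoffel_form_conformal[OF nz grad])
  also have "\<dots> = gram_defect f ((1 / \<sigma> (f x)) *\<^sub>R g)"
    unfolding gram_defect_def
    by (intro sum.cong refl) (simp add: conformal_form_def inner_commute algebra_simps scaleR_2[symmetric])
  finally show ?thesis .
qed

lemma inner_vec_2: "(u::real^2) \<bullet> v = u $ 1 * v $ 1 + u $ 2 * v $ 2"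
  by (simp add: inner_vec_def sum_2)

text \<open>In two dimensions the defect operator is the symmetric trace-free matrix with rows
  \<open>(m, n)\<close> and \<open>(n, -m)\<close>.\<close>
lemma gram_defect_2:
  fixes f :: "real ^ 'm::finite \<Rightarrow> real ^ 2"
  defines "m \<equiv> (\<Sum>i\<in>UNIV. (f (axis i 1) $ 1)\<^sup>2 - (f (axis i 1) $ 2)\<^sup>2)"
    and "n \<equiv> (\<Sum>i\<in>UNIV. 2 * f (axis i 1) $ 1 * f (axis i 1) $ 2)"
  shows "gram_defect f v $ 1 = m * v $ 1 + n * v $ 2"
    and "gram_defect f v $ 2 = n * v $ 1 - m * v $ 2"
  unfolding gram_defect_def m_def n_def sum_distrib_right
    sum_component sum.distrib[symmetric] sum_subtractf[symmetric]
  by (intro sum.cong refl; simp add: inner_vec_2 algebra_simps power2_eq_square)+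

text \<open>This is the Cayley-Hamilton theorem for a trace-free matrix \<open>M\<close> of size two: \<open>M\<^sup>2\<close> is the scalar
  \<open>tr(M\<^sup>2)/2\<close>. The scalar is written as \<open>tr(M f f\<^sup>T)\<close>, which is the same number since
  \<open>2 f f\<^sup>T - M\<close> is scalar and \<open>tr M = 0\<close>, because this is the form in which the trace of the second
  derivatives of the tension field produces it.\<close>
lemma gram_defect_square:
  fixes f :: "real ^ 'm::finite \<Rightarrow> real ^ 2"
  shows "gram_defect f (gram_defect f v) =
    (\<Sum>i\<in>UNIV. f (axis i 1) \<bullet> gram_defect f (f (axis i 1))) *\<^sub>R v"
proof -
  define m n where "m = (\<Sum>i\<in>UNIV. (f (axis i 1) $ 1)\<^sup>2 - (f (axis i 1) $ 2)\<^sup>2)"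
    and "n = (\<Sum>i\<in>UNIV. 2 * f (axis i 1) $ 1 * f (axis i 1) $ 2)"
  note M = gram_defect_2[of f, folded m_def n_def]
  have "(\<Sum>i\<in>UNIV. f (axis i 1) \<bullet> gram_defect f (f (axis i 1))) =
     (\<Sum>i\<in>UNIV. m * ((f (axis i 1) $ 1)\<^sup>2 - (f (axis i 1) $ 2)\<^sup>2) + n * (2 * f (axis i 1) $ 1 * f (axis i 1) $ 2))"
    by (intro sum.cong refl) (simp add: inner_vec_2 M algebra_simps power2_eq_square)
  also have "\<dots> = m * m + n * n"
    by (simp only: sum.distrib sum_distrib_left[symmetric] m_def[symmetric] n_def[symmetric])
  finally show ?thesis
    by (simp add: vec_eq_iff forall_2 M algebra_simps)
qed

section \<open>Biharmonicity for a conformal factor with constant scalar Hessian\<close>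

text \<open>Having \<open>k\<close> times the identity as Hessian is what the equation \<open>\<sigma>\<^bsub>ww\<^esub> = 0\<close> amounts to for real
  \<open>\<sigma>\<close> on the plane. The factor may have either sign, because the metric depends on \<open>\<sigma>\<^sup>2\<close> only.\<close>
locale radial_hessian =
  fixes \<sigma> :: "real ^ 'n::finite \<Rightarrow> real" and G :: "real ^ 'n \<Rightarrow> real ^ 'n" and k :: real
  assumes nonzero: "\<sigma> w \<noteq> 0"
    and gradient: "(\<sigma> has_derivative (\<lambda>h. G w \<bullet> h)) (at w)"
    and hessian: "(G has_derivative (\<lambda>h. k *\<^sub>R h)) (at w)"
begin

definition L :: "real ^ 'n \<Rightarrow> real ^ 'n" where "L w = (1 / \<sigma> w) *\<^sub>R G w"
definition \<kappa> :: "real ^ 'n \<Rightarrow> real" where "\<kappa> w = k / \<sigma> w"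

lemma deriv_\<kappa>: "(\<kappa> has_derivative (\<lambda>h. - \<kappa> w * (L w \<bullet> h))) (at w)"
  unfolding \<kappa>_def[abs_def]
  by (rule derivative_eq_intros gradient nonzero refl)+
    (simp add: fun_eq_iff L_def field_simps)

lemma deriv_L: "(L has_derivative (\<lambda>h. \<kappa> w *\<^sub>R h - (L w \<bullet> h) *\<^sub>R L w)) (at w)"
  unfolding L_def[abs_def]
  by (rule derivative_eq_intros gradient hessian nonzero refl)+
    (simp add: fun_eq_iff \<kappa>_def inner_simps field_simps)

lemma pullback_deriv_conformal:
  assumes "linear f" "(V has_derivative V') (at x)"
  shows "pullback_deriv (conformal_metric \<sigma>) f X V x = V' X + conformal_form (L (f x)) (f X) (V x)"
  using assms frechet_derivative_at[OF assms(2)]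
  by (simp add: pullback_deriv_def frechet_derivative_linear L_def
      christoffel_form_conformal[OF nonzero gradient])

lemma deriv_conformal_form:
  "((\<lambda>w. conformal_form (L w) Y Z) has_derivative
    (\<lambda>h. conformal_form (\<kappa> w *\<^sub>R h - (L w \<bullet> h) *\<^sub>R L w) Y Z)) (at w)"
  unfolding conformal_form_def
  by (rule derivative_eq_intros deriv_L refl)+ simp

lemma deriv_L_linear:
  fixes f :: "'a::euclidean_space \<Rightarrow> real ^ 'n"
  assumes "linear f"
  shows "((\<lambda>x. L (f x)) has_derivative
    (\<lambda>h. \<kappa> (f x) *\<^sub>R f h - (L (f x) \<bullet> f h) *\<^sub>R L (f x))) (at x)"
  using has_derivative_compose[OF linear_imp_has_derivative[OF assms] deriv_L] .

lemma deriv_\<kappa>_linear: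
  fixes f :: "'a::euclidean_space \<Rightarrow> real ^ 'n"
  assumes "linear f"
  shows "((\<lambda>x. \<kappa> (f x)) has_derivative (\<lambda>h. - \<kappa> (f x) * (L (f x) \<bullet> f h))) (at x)"
  using has_derivative_compose[OF linear_imp_has_derivative[OF assms] deriv_\<kappa>] .

lemma tension_eq:
  assumes "linear f"
  shows "tension flat_metric (conformal_metric \<sigma>) f = (\<lambda>x. gram_defect f (L (f x)))"
  using tension_linear[OF assms nonzero gradient] by (simp add: fun_eq_iff L_def)

text \<open>The two terms \<open>(L \<bullet> f X) M L\<close>, one from the derivative of \<open>L\<close> and one from the connection,
  cancel.\<close>
lemma first_deriv_tension:
  assumes lin: "linear f"
  shows "pullback_deriv (conformal_metric \<sigma>) f X (\<lambda>x. gram_defect f (L (f x))) = (\<lambda>x.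
     \<kappa> (f x) *\<^sub>R gram_defect f (f X) + (L (f x) \<bullet> gram_defect f (L (f x))) *\<^sub>R f X
     - (f X \<bullet> gram_defect f (L (f x))) *\<^sub>R L (f x))"
  unfolding fun_eq_iff
  by (subst pullback_deriv_conformal[OF lin
        bounded_linear.has_derivative[OF bounded_linear_gram_defect deriv_L_linear[OF lin]]])
    (simp add: conformal_form_def gram_defect_diff gram_defect_scaleR)

text \<open>Both derivatives are in the same direction, as in the trace over the source. The two
  multiples of \<open>M (f X)\<close> cancel, where \<open>M\<close> is the defect operator, and those of \<open>f X\<close> and of \<open>L\<close>
  combine because \<open>M\<close> is self-adjoint.\<close>
lemma second_deriv_tension:
  assumes lin: "linear f"
  shows "pullback_deriv (conformal_metric \<sigma>) f X
      (pullback_deriv (conformal_metric \<sigma>) f X (tension flat_metric (conformal_metric \<sigma>) f)) x =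
    (2 * \<kappa> (f x) - L (f x) \<bullet> L (f x)) *\<^sub>R (f X \<bullet> gram_defect f (L (f x))) *\<^sub>R f X
    - (2 * \<kappa> (f x) * (f X \<bullet> gram_defect f (f X))
       - 2 * (L (f x) \<bullet> f X) * (f X \<bullet> gram_defect f (L (f x)))
       + (f X \<bullet> f X) * (L (f x) \<bullet> gram_defect f (L (f x)))) *\<^sub>R L (f x)"
proof -
  let ?M = "gram_defect f" and ?P = "f X"
  let ?D = "\<lambda>h. \<kappa> (f x) *\<^sub>R f h - (L (f x) \<bullet> f h) *\<^sub>R L (f x)"
  let ?W = "\<lambda>x. \<kappa> (f x) *\<^sub>R ?M ?P + (L (f x) \<bullet> ?M (L (f x))) *\<^sub>R ?P - (?P \<bullet> ?M (L (f x))) *\<^sub>R L (f x)"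
  have "(?W has_derivative (\<lambda>h. (- \<kappa> (f x) * (L (f x) \<bullet> f h)) *\<^sub>R ?M ?P
      + (2 * (?D h \<bullet> ?M (L (f x)))) *\<^sub>R ?P
      - ((?P \<bullet> ?M (?D h)) *\<^sub>R L (f x) + (?P \<bullet> ?M (L (f x))) *\<^sub>R ?D h))) (at x)"
    by (rule derivative_eq_intros deriv_L_linear[OF lin] deriv_\<kappa>_linear[OF lin]
        bounded_linear.has_derivative[OF bounded_linear_gram_defect] refl)+
      (simp add: fun_eq_iff inner_gram_defect_commute[symmetric] inner_commute)
  from pullback_deriv_conformal[OF lin this, of X] show ?thesis
    unfolding tension_eq[OF lin] first_deriv_tension[OF lin]
    by (simp add: conformal_form_def gram_defect_diff gram_defect_scaleR
        inner_simps inner_commute inner_gram_defect_commute vec_eq_iff algebra_simps)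
qed

text \<open>Only in dimension two do the last two summands reduce to a multiple of the bracket in the first
  two; in higher dimensions the curvature of such a metric need not have that form.\<close>
lemma curvature_components:
  "curvature (conformal_metric \<sigma>) p X Y Z =
    (2 * \<kappa> p) *\<^sub>R ((X \<bullet> Z) *\<^sub>R Y - (Y \<bullet> Z) *\<^sub>R X)
    + (L p \<bullet> L p) *\<^sub>R ((X \<bullet> Z) *\<^sub>R Y - (Y \<bullet> Z) *\<^sub>R X)
    + (2 * (L p \<bullet> Z)) *\<^sub>R ((L p \<bullet> Y) *\<^sub>R X - (L p \<bullet> X) *\<^sub>R Y)
    + (2 * ((L p \<bullet> X) * (Y \<bullet> Z) - (L p \<bullet> Y) * (X \<bullet> Z))) *\<^sub>R L p"
proof -
  have lin: "linear (\<lambda>q :: real ^ 'n. q)" by (rule linear_ident)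
  have first: "pullback_deriv (conformal_metric \<sigma>) (\<lambda>q. q) Y (\<lambda>_. Z) = (\<lambda>q. conformal_form (L q) Y Z)"
    for Y by (simp add: fun_eq_iff pullback_deriv_conformal[OF lin has_derivative_const])
  show ?thesis
    unfolding curvature_def Let_def first pullback_deriv_conformal[OF lin deriv_conformal_form]
    by (simp add: conformal_form_def inner_simps inner_commute vec_eq_iff algebra_simps)
qed

end

text \<open>In the plane the terms of the curvature that are quadratic in \<open>L\<close> collapse to a multiple of
  \<open>|L|\<^sup>2\<close>, because any three vectors are linearly dependent. What remains is the curvature tensor of
  a surface, with \<open>2 \<kappa> - |L|\<^sup>2\<close> in the place of \<open>-\<sigma>\<^sup>2\<close> times the Gauss curvature.\<close>
lemma curvature_2:
  fixes \<sigma> :: "real ^ 2 \<Rightarrow> real"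
  assumes "radial_hessian \<sigma> G k"
  defines "L \<equiv> radial_hessian.L \<sigma> G" and "\<kappa> \<equiv> radial_hessian.\<kappa> \<sigma> k"
  shows "curvature (conformal_metric \<sigma>) p X Y Z =
    (2 * \<kappa> p - L p \<bullet> L p) *\<^sub>R ((X \<bullet> Z) *\<^sub>R Y - (Y \<bullet> Z) *\<^sub>R X)"
  unfolding radial_hessian.curvature_components[OF assms(1)] L_def[symmetric] \<kappa>_def[symmetric]
  by (simp add: vec_eq_iff forall_2 inner_vec_2 algebra_simps)

text \<open>Both parts of the bitension field are multiples of \<open>C = 2 \<kappa> - |L|\<^sup>2\<close>, and their difference is
  \<open>C (M \<tau> - \<mu> L)\<close>, which is zero by the Cayley-Hamilton identity \<open>M\<^sup>2 = \<mu>\<close>.\<close>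
theorem biharmonic_linear:
  fixes f :: "real ^ 'm::finite \<Rightarrow> real ^ 2"
  assumes lin: "linear f" and rh: "radial_hessian \<sigma> G k"
  shows "biharmonic_map flat_metric (conformal_metric \<sigma>) f"
  unfolding biharmonic_map_def
proof
  fix x
  interpret radial_hessian \<sigma> G k by fact
  let ?h = "conformal_metric \<sigma>" and ?M = "gram_defect f" and ?P = "\<lambda>i. f (axis i 1)"
  define l \<tau> where "l = L (f x)" and "\<tau> = ?M l"
  define C where "C = 2 * \<kappa> (f x) - l \<bullet> l"
  have tau: "tension flat_metric ?h f x = \<tau>"
    by (simp add: tension_eq[OF lin] \<tau>_def l_def)
  define \<mu> where "\<mu> = (\<Sum>i\<in>UNIV. ?P i \<bullet> ?M (?P i))"
  have sq: "?M \<tau> = \<mu> *\<^sub>R l"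
    unfolding \<tau>_def \<mu>_def by (rule gram_defect_square)
  \<comment> \<open>The correction term of the second covariant derivative is a derivative in the direction of
    the Christoffel form of the source, which is flat.\<close>
  have zero: "pullback_deriv ?h f 0 (tension flat_metric ?h f) x = 0"
    unfolding tension_eq[OF lin] first_deriv_tension[OF lin]
    using linear_0[OF lin] gram_defect_scaleR[of f 0] by simp
  have "bitension flat_metric ?h f x = (\<Sum>i\<in>UNIV.
      pullback_deriv ?h f (axis i 1) (pullback_deriv ?h f (axis i 1) (tension flat_metric ?h f)) x)
    - (\<Sum>i\<in>UNIV. curvature ?h (f x) (?P i) \<tau> (?P i))"
    unfolding bitension_def metric_trace_flat
    by (simp add: frechet_derivative_linear[OF lin] zero tau)
  also have "(\<Sum>i\<in>UNIV. curvature ?h (f x) (?P i) \<tau> (?P i)) =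
      (\<Sum>i\<in>UNIV. C *\<^sub>R ((?P i \<bullet> ?P i) *\<^sub>R \<tau> - (?P i \<bullet> \<tau>) *\<^sub>R ?P i))"
    unfolding curvature_2[OF rh] C_def l_def by (simp add: inner_commute)
  \<comment> \<open>The coefficient of \<open>l\<close> is grouped so that its sum over \<open>i\<close> contains the defect operator at \<open>\<tau>\<close>.\<close>
  also have "(\<Sum>i\<in>UNIV. pullback_deriv ?h f (axis i 1) (pullback_deriv ?h f (axis i 1) (tension flat_metric ?h f)) x)
    = (\<Sum>i\<in>UNIV. C *\<^sub>R (?P i \<bullet> \<tau>) *\<^sub>R ?P i - (2 * \<kappa> (f x) * (?P i \<bullet> ?M (?P i))
        - l \<bullet> ((2 * (?P i \<bullet> \<tau>)) *\<^sub>R ?P i - (?P i \<bullet> ?P i) *\<^sub>R \<tau>)) *\<^sub>R l)"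
    unfolding second_deriv_tension[OF lin] C_def \<tau>_def l_def
    by (intro sum.cong refl) (simp add: inner_simps algebra_simps)
  also have "\<dots> = (\<Sum>i\<in>UNIV. C *\<^sub>R (?P i \<bullet> \<tau>) *\<^sub>R ?P i) - (2 * \<kappa> (f x) * \<mu> - l \<bullet> ?M \<tau>) *\<^sub>R l"
    unfolding \<mu>_def gram_defect_def[of f \<tau>]
    by (simp only: sum_subtractf scaleR_sum_left[symmetric] inner_sum_right[symmetric] sum_distrib_left[symmetric])
  also have "2 * \<kappa> (f x) * \<mu> - l \<bullet> ?M \<tau> = C * \<mu>"
    unfolding sq C_def by (simp add: algebra_simps)
  also have "(\<Sum>i\<in>UNIV. C *\<^sub>R (?P i \<bullet> \<tau>) *\<^sub>R ?P i) - (C * \<mu>) *\<^sub>R l -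
      (\<Sum>i\<in>UNIV. C *\<^sub>R ((?P i \<bullet> ?P i) *\<^sub>R \<tau> - (?P i \<bullet> \<tau>) *\<^sub>R ?P i)) =
    (\<Sum>i\<in>UNIV. C *\<^sub>R (?P i \<bullet> \<tau>) *\<^sub>R ?P i - C *\<^sub>R ((?P i \<bullet> ?P i) *\<^sub>R \<tau> - (?P i \<bullet> \<tau>) *\<^sub>R ?P i))
      - (C * \<mu>) *\<^sub>R l"
    by (simp only: sum_subtractf diff_diff_eq add.commute)
  also have "\<dots> = C *\<^sub>R ?M \<tau> - (C * \<mu>) *\<^sub>R l"
    unfolding gram_defect_def[of f \<tau>] scaleR_sum_right
    by (intro arg_cong2[of _ _ _ _ minus] sum.cong refl) (simp add: vec_eq_iff algebra_simps)
  also have "\<dots> = 0" by (simp add: sq)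
  finally show "bitension flat_metric ?h f x = 0" .
qed

section \<open>Conformal factors with vanishing second holomorphic derivative\<close>

abbreviation dir_deriv :: "'a::real_normed_vector \<Rightarrow> ('a \<Rightarrow> 'b::real_normed_vector) \<Rightarrow> 'a \<Rightarrow> 'b" where
  "dir_deriv v f x \<equiv> frechet_derivative f (at x) v"

lemma smooth_differentiable: "smooth f \<Longrightarrow> f differentiable (at x)"
  unfolding smooth_def by (metis times_differentiable.simps(2))

lemma smooth_dir_deriv: "smooth f \<Longrightarrow> smooth (dir_deriv v f)"
  unfolding smooth_def by (metis times_differentiable.simps(2))

lemma smooth_isCont: "smooth f \<Longrightarrow> isCont f x"
  by (simp add: differentiable_imp_continuous_within smooth_differentiable)

lemma dir_deriv_mvt:
  fixes f :: "'a::real_normed_vector \<Rightarrow> real"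
  assumes diff: "\<And>y. f differentiable (at y)" and t: "t > 0"
  obtains s where "0 < s" "s < t" "f (x + t *\<^sub>R v) - f x = t * dir_deriv v f (x + s *\<^sub>R v)"
proof -
  have "((\<lambda>s. f (x + s *\<^sub>R v)) has_real_derivative dir_deriv v f (x + s *\<^sub>R v)) (at s)" for s
  proof -
    have f: "(f has_derivative frechet_derivative f (at (x + s *\<^sub>R v))) (at (x + s *\<^sub>R v))"
      using diff frechet_derivative_works by blast
    have g: "((\<lambda>s. x + s *\<^sub>R v) has_derivative (\<lambda>r. r *\<^sub>R v)) (at s)"
      by (auto intro!: derivative_eq_intros)
    have "((\<lambda>s. f (x + s *\<^sub>R v)) has_derivative (\<lambda>r. dir_deriv (r *\<^sub>R v) f (x + s *\<^sub>R v))) (at s)"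
      using has_derivative_compose[OF g f] .
    moreover have "dir_deriv (r *\<^sub>R v) f (x + s *\<^sub>R v) = dir_deriv v f (x + s *\<^sub>R v) * r" for r
      using linear_cmul[OF linear_frechet_derivative[OF diff]] by simp
    ultimately show ?thesis by (simp add: has_field_derivative_def)
  qed
  from MVT2[OF t this] that show ?thesis by auto
qed

text \<open>The mean value theorem is applied to \<open>y \<mapsto> f (y + t v) - f y\<close> in direction \<open>u\<close> and then to the
  \<open>u\<close>-derivative of \<open>f\<close> in direction \<open>v\<close>.\<close>
lemma second_difference_mvt:
  fixes f :: "'a::real_normed_vector \<Rightarrow> real"
  assumes f: "smooth f" and t: "t > 0"
  obtains p where "dist p x \<le> t * (norm u + norm v)"
    "f (x + t *\<^sub>R u + t *\<^sub>R v) - f (x + t *\<^sub>R u) - f (x + t *\<^sub>R v) + f x = t * t * dir_deriv v (dir_deriv u f) p"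
proof -
  let ?g = "\<lambda>y. f (y + t *\<^sub>R v) - f y"
  have der: "(?g has_derivative (\<lambda>h. dir_deriv h f (y + t *\<^sub>R v) - dir_deriv h f y)) (at y)" for y
  proof -
    have f': "(f has_derivative frechet_derivative f (at z)) (at z)" for z
      using smooth_differentiable[OF f] frechet_derivative_works by blast
    have "((\<lambda>y. y + t *\<^sub>R v) has_derivative (\<lambda>h. h)) (at y)"
      by (auto intro!: derivative_eq_intros)
    from has_derivative_compose[OF this f'] show ?thesis
      by (rule has_derivative_diff) (rule f')
  qed
  obtain s where s: "0 < s" "s < t" "?g (x + t *\<^sub>R u) - ?g x = t * dir_deriv u ?g (x + s *\<^sub>R u)"
    using dir_deriv_mvt[of ?g t x u] der t unfolding differentiable_def by blast
  obtain r where r: "0 < r" "r < t" "dir_deriv u f (x + s *\<^sub>R u + t *\<^sub>R v) - dir_deriv u f (x + s *\<^sub>R u)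
      = t * dir_deriv v (dir_deriv u f) (x + s *\<^sub>R u + r *\<^sub>R v)"
    using dir_deriv_mvt[of "dir_deriv u f" t "x + s *\<^sub>R u" v] smooth_differentiable[OF smooth_dir_deriv[OF f]] t
    by blast
  have "dir_deriv u ?g (x + s *\<^sub>R u) = dir_deriv u f (x + s *\<^sub>R u + t *\<^sub>R v) - dir_deriv u f (x + s *\<^sub>R u)"
    using frechet_derivative_at[OF der] by metis
  then have "?g (x + t *\<^sub>R u) - ?g x = t * (t * dir_deriv v (dir_deriv u f) (x + s *\<^sub>R u + r *\<^sub>R v))"
    using s(3) r(3) by (simp only:)
  then have "f (x + t *\<^sub>R u + t *\<^sub>R v) - f (x + t *\<^sub>R u) - f (x + t *\<^sub>R v) + f x
      = t * t * dir_deriv v (dir_deriv u f) (x + s *\<^sub>R u + r *\<^sub>R v)"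
    by simp
  moreover have "dist (x + s *\<^sub>R u + r *\<^sub>R v) x \<le> t * (norm u + norm v)"
  proof -
    have "dist (x + s *\<^sub>R u + r *\<^sub>R v) x \<le> s * norm u + r * norm v"
      using norm_triangle_ineq[of "s *\<^sub>R u" "r *\<^sub>R v"] s r by (simp add: dist_norm)
    also have "\<dots> \<le> t * (norm u + norm v)"
      unfolding distrib_left using s r by (intro add_mono mult_right_mono) auto
    finally show ?thesis .
  qed
  ultimately show ?thesis using that by blast
qed

text \<open>The second difference of \<open>f\<close> is symmetric in \<open>u\<close> and \<open>v\<close>, so at points arbitrarily close to \<open>x\<close>
  the two mixed derivatives take equal values; continuity carries this to \<open>x\<close>.\<close>
lemma dir_deriv_commute:
  fixes f :: "'a::real_normed_vector \<Rightarrow> real"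
  assumes f: "smooth f"
  shows "dir_deriv u (dir_deriv v f) x = dir_deriv v (dir_deriv u f) x"
proof -
  define t where "t n = inverse (real (Suc n))" for n
  have t: "t n > 0" for n by (simp add: t_def)
  have "\<exists>z. dist (fst z) x \<le> t n * (norm u + norm v) \<and> dist (snd z) x \<le> t n * (norm u + norm v) \<and>
      dir_deriv v (dir_deriv u f) (fst z) = dir_deriv u (dir_deriv v f) (snd z)" for n
  proof -
    obtain p where p: "dist p x \<le> t n * (norm u + norm v)"
      "f (x + t n *\<^sub>R u + t n *\<^sub>R v) - f (x + t n *\<^sub>R u) - f (x + t n *\<^sub>R v) + f x
        = t n * t n * dir_deriv v (dir_deriv u f) p"
      by (rule second_difference_mvt[OF f t])
    obtain q where q: "dist q x \<le> t n * (norm v + norm u)"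
      "f (x + t n *\<^sub>R v + t n *\<^sub>R u) - f (x + t n *\<^sub>R v) - f (x + t n *\<^sub>R u) + f x
        = t n * t n * dir_deriv u (dir_deriv v f) q"
      by (rule second_difference_mvt[OF f t])
    have "x + t n *\<^sub>R v + t n *\<^sub>R u = x + t n *\<^sub>R u + t n *\<^sub>R v"
      by simp
    then have "t n * t n * dir_deriv v (dir_deriv u f) p = t n * t n * dir_deriv u (dir_deriv v f) q"
      using p(2) q(2) by (simp only:)
    then have "dir_deriv v (dir_deriv u f) p = dir_deriv u (dir_deriv v f) q"
      using t[of n] unfolding mult_cancel_left by force
    then show ?thesis
      using p(1) q(1) by (intro exI[of _ "(p, q)"]) (simp add: add.commute)
  qed
  then have "\<forall>n. \<exists>z. dist (fst z) x \<le> t n * (norm u + norm v) \<and> dist (snd z) x \<le> t n * (norm u + norm v) \<and>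
      dir_deriv v (dir_deriv u f) (fst z) = dir_deriv u (dir_deriv v f) (snd z)" by blast
  from choice[OF this] obtain z where
    p: "\<And>n. dist (fst (z n)) x \<le> t n * (norm u + norm v)" and
    q: "\<And>n. dist (snd (z n)) x \<le> t n * (norm u + norm v)" and
    eq: "\<And>n. dir_deriv v (dir_deriv u f) (fst (z n)) = dir_deriv u (dir_deriv v f) (snd (z n))"
    by blast
  have "(\<lambda>n. t n * (norm u + norm v)) \<longlonglongrightarrow> 0"
    unfolding t_def by (rule tendsto_mult_left_zero[OF LIMSEQ_inverse_real_of_nat])
  then have lim: "r \<longlonglongrightarrow> x" if "\<And>n. dist (r n) x \<le> t n * (norm u + norm v)" for r
  proof (rule metric_tendsto_imp_tendsto)
    have "dist (r n) x \<le> dist (t n * (norm u + norm v)) 0" for n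
      using that[of n] by (simp only: dist_real_def diff_0_right)
    then show "\<forall>\<^sub>F n in sequentially. dist (r n) x \<le> dist (t n * (norm u + norm v)) 0"
      by simp
  qed
  have "(\<lambda>n. dir_deriv v (dir_deriv u f) (fst (z n))) \<longlonglongrightarrow> dir_deriv v (dir_deriv u f) x"
    by (rule isCont_tendsto_compose[OF smooth_isCont lim[OF p]]) (intro smooth_dir_deriv f)
  moreover have "(\<lambda>n. dir_deriv u (dir_deriv v f) (snd (z n))) \<longlonglongrightarrow> dir_deriv u (dir_deriv v f) x"
    by (rule isCont_tendsto_compose[OF smooth_isCont lim[OF q]]) (intro smooth_dir_deriv f)
  ultimately show ?thesis unfolding eq by (rule LIMSEQ_unique[symmetric])
qed

definition grad :: "(real ^ 2 \<Rightarrow> real) \<Rightarrow> real ^ 2 \<Rightarrow> real ^ 2" where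
  "grad f w = vector [partial_deriv 1 f w, partial_deriv 2 f w]"

lemma has_derivative_partials:
  fixes f :: "real ^ 2 \<Rightarrow> 'b::real_normed_vector"
  assumes "f differentiable (at w)"
  shows "(f has_derivative (\<lambda>h. h $ 1 *\<^sub>R partial_deriv 1 f w + h $ 2 *\<^sub>R partial_deriv 2 f w)) (at w)"
proof -
  have "frechet_derivative f (at w) h = h $ 1 *\<^sub>R partial_deriv 1 f w + h $ 2 *\<^sub>R partial_deriv 2 f w" for h
  proof -
    have "h = h $ 1 *\<^sub>R axis 1 1 + h $ 2 *\<^sub>R axis 2 1"
      by (simp add: vec_eq_iff forall_2 axis_def)
    then have "frechet_derivative f (at w) h = frechet_derivative f (at w) (h $ 1 *\<^sub>R axis 1 1 + h $ 2 *\<^sub>R axis 2 1)"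
      by simp
    then show ?thesis
      using linear_frechet_derivative[OF assms]
      by (simp add: linear_add linear_cmul partial_deriv_def)
  qed
  then have "frechet_derivative f (at w) = (\<lambda>h. h $ 1 *\<^sub>R partial_deriv 1 f w + h $ 2 *\<^sub>R partial_deriv 2 f w)"
    by blast
  then show ?thesis using assms frechet_derivative_works[of f "at w"] by simp
qed

lemma has_derivative_grad:
  assumes "f differentiable (at w)"
  shows "(f has_derivative (\<lambda>h. grad f w \<bullet> h)) (at w)"
  using has_derivative_partials[OF assms]
  by (simp add: grad_def inner_vec_2 vector_2 mult.commute)

text \<open>For \<open>f = \<sigma>\<^sub>u\<close> and \<open>g = \<sigma>\<^sub>v\<close> the left-hand side is \<open>\<sigma>\<^bsub>ww\<^esub>\<close>.\<close>
lemma d_hol_split: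
  assumes f: "f differentiable (at w)" and g: "g differentiable (at w)"
  shows "d_hol (\<lambda>w. (complex_of_real (f w) - \<i> * complex_of_real (g w)) / 2) w =
     Complex (partial_deriv 1 f w - partial_deriv 2 g w) (- partial_deriv 1 g w - partial_deriv 2 f w) / 4"
proof -
  have "partial_deriv i (\<lambda>w. (complex_of_real (f w) - \<i> * complex_of_real (g w)) / 2) w =
     (complex_of_real (partial_deriv i f w) - \<i> * complex_of_real (partial_deriv i g w)) / 2" for i
  proof -
    have "(f has_derivative frechet_derivative f (at w)) (at w)"
      "(g has_derivative frechet_derivative g (at w)) (at w)"
      using assms frechet_derivative_works by blast+
    then have "((\<lambda>w. (complex_of_real (f w) - \<i> * complex_of_real (g w)) / 2) has_derivative
      (\<lambda>h. (complex_of_real (frechet_derivative f (at w) h) - \<i> * complex_of_real (frechet_derivative g (at w) h)) / 2)) (at w)"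
      by (auto intro!: derivative_eq_intros)
    from partial_deriv_eq[OF this] show ?thesis by (simp add: partial_deriv_def)
  qed
  then show ?thesis
    unfolding d_hol_def by (simp only:) (simp add: complex_eq_iff)
qed

lemma d_hol_real:
  assumes "f differentiable (at w)"
  shows "d_hol (\<lambda>w. complex_of_real (f w)) w =
     (complex_of_real (partial_deriv 1 f w) - \<i> * complex_of_real (partial_deriv 2 f w)) / 2"
proof -
  have "(f has_derivative frechet_derivative f (at w)) (at w)"
    using assms frechet_derivative_works by blast
  then have "((\<lambda>w. complex_of_real (f w)) has_derivative
      (\<lambda>h. complex_of_real (frechet_derivative f (at w) h))) (at w)"
    by (auto intro!: derivative_eq_intros)
  from partial_deriv_eq[OF this] show ?thesis
    unfolding d_hol_def by (simp add: partial_deriv_def)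
qed

lemma anti_analytic_on_iff_grad:
  assumes "\<And>w. \<sigma> differentiable (at w)"
  shows "anti_analytic_on S \<sigma> \<longleftrightarrow> (\<forall>w\<in>S. grad \<sigma> w = 0)"
  unfolding anti_analytic_on_def
  by (intro ball_cong refl)
    (simp add: d_hol_real[OF assms] grad_def complex_eq_iff vec_eq_iff forall_2 vector_2)

text \<open>The real and imaginary parts of \<open>4 \<sigma>\<^bsub>ww\<^esub>\<close> are \<open>\<sigma>\<^bsub>uu\<^esub> - \<sigma>\<^bsub>vv\<^esub>\<close> and \<open>-2 \<sigma>\<^bsub>uv\<^esub>\<close>. Hence
  \<open>\<sigma>\<^bsub>uuv\<^esub> = \<sigma>\<^bsub>uvu\<^esub> = 0\<close> and \<open>\<sigma>\<^bsub>uuu\<^esub> = \<sigma>\<^bsub>vvu\<^esub> = \<sigma>\<^bsub>uvv\<^esub> = 0\<close>, so that \<open>\<sigma>\<^bsub>uu\<^esub> = \<sigma>\<^bsub>vv\<^esub>\<close> is constant.\<close>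
lemma anti_bianalytic_hessian:
  assumes \<sigma>: "smooth \<sigma>" and bi: "anti_bianalytic \<sigma>"
  shows "\<exists>k. \<forall>w. (grad \<sigma> has_derivative (\<lambda>h. k *\<^sub>R h)) (at w)"
proof -
  define D where "D i = (partial_deriv i :: (real ^ 2 \<Rightarrow> real) \<Rightarrow> _)" for i :: 2
  have D_dir: "D i f = dir_deriv (axis i 1) f" for i f
    by (simp add: D_def partial_deriv_def fun_eq_iff)
  have smooth: "smooth (D i f)" if "smooth f" for i f
    unfolding D_dir using that by (rule smooth_dir_deriv)
  have comm: "D i (D j f) = D j (D i f)" if "smooth f" for i j f
    unfolding D_dir using dir_deriv_commute[OF that] by blast
  note diff = smooth_differentiable
  have "D 1 (D 1 \<sigma>) w = D 2 (D 2 \<sigma>) w \<and> - D 1 (D 2 \<sigma>) w - D 2 (D 1 \<sigma>) w = 0" for w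
  proof -
    have "d_hol (\<lambda>w. complex_of_real (\<sigma> w)) = (\<lambda>w. (complex_of_real (D 1 \<sigma> w) - \<i> * complex_of_real (D 2 \<sigma> w)) / 2)"
      using d_hol_real[OF diff[OF \<sigma>]] by (simp add: fun_eq_iff D_def)
    then have "d_hol (\<lambda>w. (complex_of_real (D 1 \<sigma> w) - \<i> * complex_of_real (D 2 \<sigma> w)) / 2) w = 0"
      using bi by (simp add: anti_bianalytic_def)
    then show ?thesis
      unfolding d_hol_split[OF diff[OF smooth[OF \<sigma>]] diff[OF smooth[OF \<sigma>]]] D_def[symmetric]
      by (simp add: complex_eq_iff)
  qed
  then have eq: "D 1 (D 1 \<sigma>) = D 2 (D 2 \<sigma>)" and mixed: "D 1 (D 2 \<sigma>) = (\<lambda>_. 0)" "D 2 (D 1 \<sigma>) = (\<lambda>_. 0)"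
    using comm[OF \<sigma>, of 1 2] by (auto simp: fun_eq_iff)
  have D0: "D i (\<lambda>_. 0) = (\<lambda>_. 0)" for i
    by (simp add: D_dir)
  have "D 1 (D 1 (D 1 \<sigma>)) = (\<lambda>_. 0)"
    unfolding eq using comm[OF smooth[OF \<sigma>], of 1 2 2] by (simp add: mixed D0)
  moreover have "D 2 (D 1 (D 1 \<sigma>)) = (\<lambda>_. 0)"
    using comm[OF smooth[OF \<sigma>], of 1 2 1] by (simp add: mixed D0)
  ultimately have "(D 1 (D 1 \<sigma>) has_derivative (\<lambda>h. 0)) (at w)" for w
    using has_derivative_partials[OF diff[OF smooth[OF smooth[OF \<sigma>]]], of 1 1 w]
    by (simp add: D_def fun_eq_iff)
  then obtain k where k: "\<And>w. D 1 (D 1 \<sigma>) w = k"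
    using has_derivative_zero_constant[of UNIV "D 1 (D 1 \<sigma>)"] by auto
  have "(grad \<sigma> has_derivative (\<lambda>h. k *\<^sub>R h)) (at w)" for w
  proof -
    have "((\<lambda>w. grad \<sigma> w $ i) has_derivative (\<lambda>h. k * h $ i)) (at w)" for i
    proof -
      have "(D i \<sigma> has_derivative (\<lambda>h. k * h $ i)) (at w)"
        using has_derivative_partials[OF diff[OF smooth[OF \<sigma>]], of i w] k k[unfolded eq] mixed exhaust_2[of i]
        by (auto simp: D_def fun_eq_iff mult.commute)
      moreover have "(\<lambda>w. grad \<sigma> w $ i) = D i \<sigma>"
        using exhaust_2[of i] by (auto simp: grad_def D_def fun_eq_iff)
      ultimately show ?thesis by simp
    qed
    then show ?thesis
      unfolding has_derivative_componentwise_within[of "grad \<sigma>"]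
      by (auto simp: Basis_vec_def inner_axis)
  qed
  then show ?thesis by blast
qed

section \<open>Harmonic linear maps\<close>

text \<open>The tension field is the defect operator applied to a nonzero multiple of \<open>G\<close>. As the square of
  the operator is the scalar \<open>m\<^sup>2 + n\<^sup>2\<close>, it has a nonzero kernel only if it is zero. Hence the pointwise
  alternative between operator and gradient is one alternative for all points.\<close>
lemma harmonic_linear_iff:
  fixes f :: "real ^ 'm::finite \<Rightarrow> real ^ 2"
  assumes "linear f" "\<And>w. \<sigma> w \<noteq> 0" "\<And>w. (\<sigma> has_derivative (\<lambda>h. G w \<bullet> h)) (at w)"
  shows "harmonic_map flat_metric (conformal_metric \<sigma>) f \<longleftrightarrow>
    (\<forall>v. gram_defect f v = 0) \<or> (\<forall>x. G (f x) = 0)"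
proof -
  define m n where "m = (\<Sum>i\<in>UNIV. (f (axis i 1) $ 1)\<^sup>2 - (f (axis i 1) $ 2)\<^sup>2)"
    and "n = (\<Sum>i\<in>UNIV. 2 * f (axis i 1) $ 1 * f (axis i 1) $ 2)"
  note M = gram_defect_2[of f, folded m_def n_def]
  have dich: "gram_defect f v = 0 \<longleftrightarrow> v = 0 \<or> (\<forall>v. gram_defect f v = 0)" for v
  proof
    assume v: "gram_defect f v = 0"
    show "v = 0 \<or> (\<forall>v. gram_defect f v = 0)"
    proof (cases "m = 0 \<and> n = 0")
      case True
      then show ?thesis by (simp add: vec_eq_iff forall_2 M)
    next
      case False
      have "(m\<^sup>2 + n\<^sup>2) *\<^sub>R v = gram_defect f (gram_defect f v)"
        by (simp add: vec_eq_iff forall_2 M algebra_simps power2_eq_square)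
      also have "\<dots> = 0" using gram_defect_scaleR[of f 0] by (simp add: v)
      finally show ?thesis using False by (auto simp: sum_power2_eq_zero_iff)
    qed
  qed (use gram_defect_scaleR[of f 0] in auto)
  have tau: "harmonic_map flat_metric (conformal_metric \<sigma>) f \<longleftrightarrow> (\<forall>x. gram_defect f (G (f x)) = 0)"
    unfolding harmonic_map_def tension_linear[OF assms(1,2,3)]
    by (simp add: gram_defect_scaleR assms(2))
  show ?thesis
  proof (cases "\<forall>v. gram_defect f v = 0")
    case False
    then have "gram_defect f v = 0 \<longleftrightarrow> v = 0" for v
      using dich[of v] by blast
    with False show ?thesis unfolding tau by blast
  qed (simp add: tau)
qed

text \<open>The condition is that the two rows of the matrix of \<open>f\<close> have equal length and are
  orthogonal.\<close>
lemma gram_defect_eq_0_iff: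
  fixes f :: "real ^ 2 \<Rightarrow> real ^ 2"
  defines "p \<equiv> f (axis 1 1)" and "q \<equiv> f (axis 2 1)"
  shows "(\<forall>v. gram_defect f v = 0) \<longleftrightarrow>
    (p $ 1)\<^sup>2 + (q $ 1)\<^sup>2 = (p $ 2)\<^sup>2 + (q $ 2)\<^sup>2 \<and> p $ 1 * p $ 2 + q $ 1 * q $ 2 = 0"
    (is "_ \<longleftrightarrow> ?m \<and> ?n")
proof
  assume 0: "\<forall>v. gram_defect f v = 0"
  have "gram_defect f (axis 1 1) $ 1 = 0" "gram_defect f (axis 1 1) $ 2 = 0"
    using 0 by simp_all
  then show "?m \<and> ?n"
    unfolding gram_defect_2 by (simp add: sum_2 p_def q_def axis_def algebra_simps)
next
  assume "?m \<and> ?n"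
  then have "(\<Sum>i\<in>UNIV. (f (axis i 1) $ 1)\<^sup>2 - (f (axis i 1) $ 2)\<^sup>2) = 0"
    "(\<Sum>i\<in>UNIV. 2 * f (axis i 1) $ 1 * f (axis i 1) $ 2) = 0"
    by (simp_all add: sum_2 p_def q_def)
  then show "\<forall>v. gram_defect f v = 0"
    by (simp add: vec_eq_iff forall_2 gram_defect_2)
qed

lemma partial_deriv_complexify:
  assumes "linear f"
  shows "partial_deriv i (complexify f) x = complexify f (axis i 1)"
proof -
  have "linear (complexify f)"
    by (rule linearI)
      (simp_all add: complexify_def complex_eq_iff linear_add[OF assms] linear_cmul[OF assms])
  then show ?thesis
    by (intro partial_deriv_eq linear_imp_has_derivative)
qed

text \<open>In complex notation the defect operator is \<open>v\<close> mapped to \<open>4 f\<^sub>z f\<^bsub>zbar\<^esub>\<close> times the conjugate of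
  \<open>v\<close>, so it vanishes if and only if one of the two factors does. In real terms this is the
  factorisation of \<open>m\<^sup>2 + n\<^sup>2\<close>, where \<open>(m, n)\<close> is the first row of the defect operator, into two
  sums of two squares, proportional to \<open>|f\<^bsub>zbar\<^esub>|\<^sup>2\<close> and
  \<open>|f\<^sub>z|\<^sup>2\<close>.\<close>
lemma gram_defect_eq_0_iff_analytic:
  fixes f :: "real ^ 2 \<Rightarrow> real ^ 2"
  assumes "linear f"
  shows "(\<forall>v. gram_defect f v = 0) \<longleftrightarrow> analytic_map f \<or> anti_analytic_map f"
proof -
  define a b c d where "a = f (axis 1 1) $ 1" and "b = f (axis 2 1) $ 1"
    and "c = f (axis 1 1) $ 2" and "d = f (axis 2 1) $ 2"
  note abcd = this
  have an: "analytic_map f \<longleftrightarrow> (a - d)\<^sup>2 + (b + c)\<^sup>2 = 0"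
    unfolding analytic_map_def d_antihol_def partial_deriv_complexify[OF assms] sum_power2_eq_zero_iff
    by (auto simp: complexify_def abcd complex_eq_iff)
  have anti: "anti_analytic_map f \<longleftrightarrow> (a + d)\<^sup>2 + (b - c)\<^sup>2 = 0"
    unfolding anti_analytic_map_def d_hol_def partial_deriv_complexify[OF assms] sum_power2_eq_zero_iff
    by (auto simp: complexify_def abcd complex_eq_iff)
  have "(\<forall>v. gram_defect f v = 0) \<longleftrightarrow>
      (a\<^sup>2 + b\<^sup>2 - (c\<^sup>2 + d\<^sup>2))\<^sup>2 + (2 * (a * c + b * d))\<^sup>2 = 0"
    unfolding gram_defect_eq_0_iff sum_power2_eq_zero_iff abcd[symmetric] by auto
  also have "(a\<^sup>2 + b\<^sup>2 - (c\<^sup>2 + d\<^sup>2))\<^sup>2 + (2 * (a * c + b * d))\<^sup>2 =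
      ((a - d)\<^sup>2 + (b + c)\<^sup>2) * ((a + d)\<^sup>2 + (b - c)\<^sup>2)"
    by algebra
  finally show ?thesis by (simp add: an anti del: sum_power2_eq_zero_iff)
qed

lemma radial_hessian_quadratic:
  assumes "\<And>w :: real ^ 2. p + q * ((w $ 1)\<^sup>2 + (w $ 2)\<^sup>2) \<noteq> 0"
  shows "radial_hessian (\<lambda>w :: real ^ 2. p + q * ((w $ 1)\<^sup>2 + (w $ 2)\<^sup>2)) (\<lambda>w. (2 * q) *\<^sub>R w) (2 * q)"
proof
  fix w :: "real ^ 2"
  show "((\<lambda>w. p + q * ((w $ 1)\<^sup>2 + (w $ 2)\<^sup>2)) has_derivative (\<bullet>) ((2 * q) *\<^sub>R w)) (at w)"
    by (auto intro!: derivative_eq_intros bounded_linear.has_derivative[OF bounded_linear_vec_nth]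
      simp: fun_eq_iff inner_vec_2 algebra_simps)
qed (use assms in \<open>auto intro!: derivative_eq_intros\<close>)

theorem theorem2p3:
  fixes \<sigma> :: "real ^ 2 \<Rightarrow> real"
    and a b c d :: real
    and \<phi> :: "real ^ 2 \<Rightarrow> real ^ 2"
    and A1 A2 :: "real ^ 2"
  assumes smooth_sigma: "smooth \<sigma>"
    and pos_sigma: "\<forall>w. \<sigma> w > 0"
    and phi: "\<phi> = (\<lambda>x. (vector [vector [a, b], vector [c, d]] :: real ^ 2 ^ 2) *v x)"
    and A1: "A1 = vector [a, b]"
    and A2: "A2 = vector [c, d]"
  shows
    "(harmonic_map flat_metric (conformal_metric \<sigma>) \<phi> \<longleftrightarrow>
        anti_analytic_on (range \<phi>) \<sigma> \<or> analytic_map \<phi> \<or> anti_analytic_map \<phi>)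
     \<and> (anti_analytic_on UNIV \<sigma> \<or> analytic_map \<phi> \<or> anti_analytic_map \<phi> \<longrightarrow>
        harmonic_map flat_metric (conformal_metric \<sigma>) \<phi>)
     \<and> (a * d - b * c \<noteq> 0 \<longrightarrow>
        (harmonic_map flat_metric (conformal_metric \<sigma>) \<phi> \<longleftrightarrow>
           anti_analytic_on UNIV \<sigma> \<or> analytic_map \<phi> \<or> anti_analytic_map \<phi>))
     \<and> (anti_bianalytic \<sigma> \<longrightarrow> biharmonic_map flat_metric (conformal_metric \<sigma>) \<phi>)
     \<and> (\<forall>p q :: real. q \<noteq> 0 \<longrightarrow>
          (\<forall>w :: real ^ 2. p + q * ((w $ 1)\<^sup>2 + (w $ 2)\<^sup>2) \<noteq> 0) \<longrightarrow>
          (norm A1)\<^sup>2 \<noteq> (norm A2)\<^sup>2 \<or> A1 \<bullet> A2 \<noteq> 0 \<longrightarrow>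
          proper_biharmonic_map flat_metric
            (conformal_metric (\<lambda>w. p + q * ((w $ 1)\<^sup>2 + (w $ 2)\<^sup>2))) \<phi>)"
proof -
  let ?h = "conformal_metric \<sigma>"
  have phi_eq: "\<phi> x $ 1 = a * x $ 1 + b * x $ 2" "\<phi> x $ 2 = c * x $ 1 + d * x $ 2" for x
    by (simp_all add: phi matrix_vector_mult_def sum_2)
  have lin: "linear \<phi>"
    unfolding phi by (rule matrix_vector_mul_linear)
  have nz: "\<sigma> w \<noteq> 0" for w
    using pos_sigma by (metis less_irrefl)
  note diff = smooth_differentiable[OF smooth_sigma]
  have harmonic: "harmonic_map flat_metric ?h \<phi> \<longleftrightarrow>
      anti_analytic_on (range \<phi>) \<sigma> \<or> analytic_map \<phi> \<or> anti_analytic_map \<phi>"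
    unfolding harmonic_linear_iff[OF lin nz has_derivative_grad[OF diff]]
      gram_defect_eq_0_iff_analytic[OF lin] anti_analytic_on_iff_grad[OF diff]
    by auto
  have range: "range \<phi> = UNIV" if "a * d - b * c \<noteq> 0"
  proof -
    have "\<phi> (vector [(d * w $ 1 - b * w $ 2) / (a * d - b * c), (a * w $ 2 - c * w $ 1) / (a * d - b * c)]) = w"
      (is "\<phi> ?x = w") for w
    proof -
      have "a * (d * w $ 1 - b * w $ 2) + b * (a * w $ 2 - c * w $ 1) = w $ 1 * (a * d - b * c)"
        "c * (d * w $ 1 - b * w $ 2) + d * (a * w $ 2 - c * w $ 1) = w $ 2 * (a * d - b * c)"
        by algebra+
      then show ?thesis
        using that by (simp add: vec_eq_iff forall_2 phi_eq add_divide_distrib[symmetric])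
    qed
    then show ?thesis unfolding surj_def by metis
  qed
  have biharmonic: "biharmonic_map flat_metric ?h \<phi>" if bi: "anti_bianalytic \<sigma>"
  proof -
    obtain k where "\<And>w. (grad \<sigma> has_derivative (\<lambda>h. k *\<^sub>R h)) (at w)"
      using anti_bianalytic_hessian[OF smooth_sigma bi] by blast
    then have "radial_hessian \<sigma> (grad \<sigma>) k"
      using nz has_derivative_grad[OF diff] by unfold_locales
    then show ?thesis by (rule biharmonic_linear[OF lin])
  qed
  have proper: "proper_biharmonic_map flat_metric
      (conformal_metric (\<lambda>w. p + q * ((w $ 1)\<^sup>2 + (w $ 2)\<^sup>2))) \<phi>"
    if q: "q \<noteq> 0" and pq: "\<forall>w :: real ^ 2. p + q * ((w $ 1)\<^sup>2 + (w $ 2)\<^sup>2) \<noteq> 0"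
      and A: "(norm A1)\<^sup>2 \<noteq> (norm A2)\<^sup>2 \<or> A1 \<bullet> A2 \<noteq> 0" for p q
  proof -
    let ?s = "\<lambda>w :: real ^ 2. p + q * ((w $ 1)\<^sup>2 + (w $ 2)\<^sup>2)"
    have rh: "radial_hessian ?s (\<lambda>w. (2 * q) *\<^sub>R w) (2 * q)"
      using radial_hessian_quadratic[of p q] pq by blast
    have norms: "(norm A1)\<^sup>2 = a\<^sup>2 + b\<^sup>2" "(norm A2)\<^sup>2 = c\<^sup>2 + d\<^sup>2" "A1 \<bullet> A2 = a * c + b * d"
      unfolding A1 A2 power2_norm_eq_inner by (simp_all add: inner_vec_2 power2_eq_square)
    have defect: "\<not> (\<forall>v. gram_defect \<phi> v = 0)"
      unfolding gram_defect_eq_0_iff using A norms by (auto simp: phi_eq axis_def)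
    have "gram_defect \<phi> v = 0" if "\<forall>x. \<phi> x = 0" for v
      using that by (simp add: gram_defect_def)
    then have "\<not> (\<forall>x. (2 * q) *\<^sub>R \<phi> x = 0)"
      using defect q by auto
    with defect have "\<not> harmonic_map flat_metric (conformal_metric ?s) \<phi>"
      using harmonic_linear_iff[OF lin radial_hessian.nonzero[OF rh] radial_hessian.gradient[OF rh]]
      by blast
    then show ?thesis
      unfolding proper_biharmonic_map_def using biharmonic_linear[OF lin rh] by blast
  qed
  have "anti_analytic_on (range \<phi>) \<sigma>" if "anti_analytic_on UNIV \<sigma>"
    using that by (simp add: anti_analytic_on_def)
  with harmonic range biharmonic proper show ?thesis by auto
qed

end
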